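(* Let $V$ and $S$ be non-empty sets with $S\subseteq V$, let $(\Omega,\mathcal F,\mathbb P)$ be a probability space, for every $k\in\{1,2\}$ let $(\mathfrak R_k,\mathcal R_k)$ be a measurable space, for every $k\in\{1,2\}$ let $R_k\colon\Omega\to\mathfrak R_k$ be a random variable, let $N\in\mathbb N$, for every $v\in V$ let $U_v\colon\mathfrak R_1\to\mathbb R^N$ be measurable, let $\phi\colon\mathfrak R_1\times\mathfrak R_2\to\mathbb R^N$ be measurable, assume $\mathbb E[\|\phi(R_1,R_2)\|^2]<\infty$, assume for all $v\in V$ that $$\mathbb P\bigl(U_v(R_1)=\mathbb E[\phi(R_1,R_2)\,|\,R_1]\bigr)=1$$ if and only if $v\in S$, and let $\ell\colon V\to[0,\infty]$ satisfy for all $v\in V$ that $$\ell(v)=\mathbb E\bigl[\|\phi(R_1,R_2)-U_v(R_1)\|^2\bigr].$$ Then (i) for all $v\in V$ it holds that $\ell(v)=\inf_{w\in V}\ell(w)$ if and only if $v\in S$, and (ii) there exists $v\in V$ such that $\ell(v)=\inf_{w\in V}\ell(w)$.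
   Context: $\mathbb N=\{1,2,3,\dots\}$. $\|\cdot\|$ is the Euclidean norm on $\mathbb R^N$. Random variables are measurable functions; $\mathfrak R_1\times\mathfrak R_2$ carries the product sigma-algebra and $\mathbb R^N$ its Borel sigma-algebra. $\mathbb E[\,\cdot\,|\,R_1]$ denotes the (componentwise) conditional expectation given the sigma-algebra generated by $R_1$. *)

theory Defs
  imports "HOL-Probability.Probability"
begin

text \<open>
  Like \<^const>\<open>real_cond_exp\<close>, this picks one version of the conditional expectation, and it is
  meaningful only if all components of \<open>Y\<close> are integrable.
\<close>

definition vec_cond_exp ::
  "'a measure \<Rightarrow> 'a measure \<Rightarrow> ('a \<Rightarrow> real ^ 'n) \<Rightarrow> 'a \<Rightarrow> real ^ 'n" where
  "vec_cond_exp M F Y = (\<lambda>\<omega>. \<chi> i. real_cond_exp M F (\<lambda>\<eta>. Y \<eta> $ i) \<omega>)"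

definition cond_exp_given ::
  "'a measure \<Rightarrow> 'r measure \<Rightarrow> ('a \<Rightarrow> 'r) \<Rightarrow> ('a \<Rightarrow> real ^ 'n) \<Rightarrow> 'a \<Rightarrow> real ^ 'n" where
  "cond_exp_given M X R Y = vec_cond_exp M (vimage_algebra (space M) R X) Y"

end

(*
  Conditional expectation is the orthogonal projection of L2 onto the functions of R1, so by
  Pythagoras L v = c + E |E[phi | R1] - U v (R1)|^2, where c < infinity does not depend on v. The second
  summand vanishes precisely for v in S, and S is nonempty, so c is the minimum.
*)
theory Submission
  imports Defs
begin

text \<open>The product is dominated by \<open>f^2 + g^2\<close>. This makes the cross terms in the
  expanded squares below integrable.\<close>

lemma integrable_mult_square_integrable:
  fixes f g :: "'a \<Rightarrow> real"
  assumes [measurable]: "f \<in> borel_measurable M" "g \<in> borel_measurable M"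
    and "integrable M (\<lambda>x. (f x)\<^sup>2)" "integrable M (\<lambda>x. (g x)\<^sup>2)"
  shows "integrable M (\<lambda>x. f x * g x)"
proof (rule Bochner_Integration.integrable_bound)
  show "integrable M (\<lambda>x. (f x)\<^sup>2 + (g x)\<^sup>2)"
    using assms by simp
  have "\<bar>a * b\<bar> \<le> \<bar>a\<^sup>2 + b\<^sup>2\<bar>" for a b :: real
  proof -
    have "0 \<le> \<bar>a\<bar> * \<bar>b\<bar>" "0 \<le> (\<bar>a\<bar> - \<bar>b\<bar>)\<^sup>2" by simp_all
    then have "\<bar>a\<bar> * \<bar>b\<bar> \<le> a\<^sup>2 + b\<^sup>2"
      unfolding power2_diff power2_abs by linarith
    then show ?thesis by (simp add: abs_mult)
  qed
  then show "AE x in M. norm (f x * g x) \<le> norm ((f x)\<^sup>2 + (g x)\<^sup>2)"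
    by simp
qed measurable

lemma integrable_square_diff:
  fixes f g :: "'a \<Rightarrow> real"
  assumes [measurable]: "f \<in> borel_measurable M" "g \<in> borel_measurable M"
    and "integrable M (\<lambda>x. (f x)\<^sup>2)" "integrable M (\<lambda>x. (g x)\<^sup>2)"
  shows "integrable M (\<lambda>x. (f x - g x)\<^sup>2)"
proof -
  have "integrable M (\<lambda>x. (f x)\<^sup>2 + (g x)\<^sup>2 - 2 * (f x * g x))"
    using assms integrable_mult_square_integrable[OF assms] by simp
  then show ?thesis by (simp add: power2_diff mult.assoc)
qed

context finite_measure_subalgebra
begin

text \<open>Conditional Jensen for the convex function \<open>x^2\<close>: the square of the
  conditional expectation is bounded by the conditional expectation of \<open>f^2\<close>.
  Integrability of \<open>f\<close> itself follows from that of \<open>f^2\<close> because the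
  measure is finite.\<close>

lemma integrable_square_real_cond_exp:
  assumes [measurable]: "f \<in> borel_measurable M" and "integrable M (\<lambda>x. (f x)\<^sup>2)"
  shows "integrable M (\<lambda>x. (real_cond_exp M F f x)\<^sup>2)"
proof (rule integrable_convex_cond_exp[where q = "\<lambda>x. x\<^sup>2" and I = UNIV])
  show "integrable M f"
    using assms by (rule square_integrable_imp_integrable)
  show "convex_on UNIV (\<lambda>x::real. x\<^sup>2)"
    by (rule convex_power2)
qed (use assms in auto)

text \<open>The residual \<open>f - E[f|F]\<close> is orthogonal to the \<open>F\<close>-measurable
  function \<open>E[f|F] - g\<close>. Stating this with nonnegative integrals also covers
  \<open>g\<close> of infinite second moment, where both sides are infinite.\<close>

lemma nn_integral_real_cond_exp_Pythagoras:
  assumes [measurable]: "f \<in> borel_measurable M" "g \<in> borel_measurable F"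
    and f2: "integrable M (\<lambda>x. (f x)\<^sup>2)"
  shows "(\<integral>\<^sup>+ x. ennreal ((f x - g x)\<^sup>2) \<partial>M)
       = (\<integral>\<^sup>+ x. ennreal ((f x - real_cond_exp M F f x)\<^sup>2) \<partial>M)
       + (\<integral>\<^sup>+ x. ennreal ((real_cond_exp M F f x - g x)\<^sup>2) \<partial>M)"
proof -
  define e where "e = real_cond_exp M F f"
  define h where "h x = e x - g x" for x
  have [measurable]: "e \<in> borel_measurable F" unfolding e_def by simp
  have [measurable]: "h \<in> borel_measurable F" unfolding h_def by measurable
  have [measurable]: "e \<in> borel_measurable M" "h \<in> borel_measurable M" "g \<in> borel_measurable M"
    by (rule measurable_from_subalg[OF subalg], measurable)+
  have e2: "integrable M (\<lambda>x. (e x)\<^sup>2)"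
    unfolding e_def using f2 by (intro integrable_square_real_cond_exp) auto
  have fe2: "integrable M (\<lambda>x. (f x - e x)\<^sup>2)"
    using f2 e2 by (intro integrable_square_diff) auto
  show ?thesis
  proof (cases "integrable M (\<lambda>x. (h x)\<^sup>2)")
    case True
    have hf: "integrable M (\<lambda>x. h x * f x)"
      using True f2 by (intro integrable_mult_square_integrable) auto
    have he: "integrable M (\<lambda>x. h x * e x)"
      using True e2 by (intro integrable_mult_square_integrable) auto
    \<comment> \<open>Orthogonality: \<open>h\<close> is \<open>F\<close>-measurable, so replacing
      \<open>f\<close> by its conditional expectation leaves the integral against \<open>h\<close>
      unchanged.\<close>
    have cross: "(\<integral>x. h x * e x \<partial>M) = (\<integral>x. h x * f x \<partial>M)"
      unfolding e_def by (rule real_cond_exp_intg(2)) (use hf in auto)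
    \<comment> \<open>Since \<open>f - g = (f - e) + h\<close>, the cross term is
      \<open>2 * h * (f - e)\<close>. Splitting it into \<open>h * f\<close> and
      \<open>h * e\<close> lets \<open>cross\<close> cancel its integral.\<close>
    have expand: "(f x - g x)\<^sup>2 = (f x - e x)\<^sup>2 + (h x)\<^sup>2 + 2 * (h x * f x - h x * e x)" for x
      unfolding h_def by (simp add: power2_eq_square algebra_simps)
    have fg2: "integrable M (\<lambda>x. (f x - g x)\<^sup>2)"
      unfolding expand using fe2 True hf he by simp
    have "(\<integral>x. (f x - g x)\<^sup>2 \<partial>M) = (\<integral>x. (f x - e x)\<^sup>2 \<partial>M) + (\<integral>x. (h x)\<^sup>2 \<partial>M)"
      unfolding expand using fe2 True hf he cross by simp
    then show ?thesis
      using fg2 fe2 True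
      by (simp add: nn_integral_eq_integral flip: e_def h_def)
  next
    case False
    \<comment> \<open>Because \<open>h = (f - g) - (f - e)\<close> and \<open>f - e\<close> is
      square integrable, square integrability of \<open>f - g\<close> would carry over to
      \<open>h\<close>. Hence both sides of the identity are infinite.\<close>
    have "\<not> integrable M (\<lambda>x. (f x - g x)\<^sup>2)"
    proof
      assume "integrable M (\<lambda>x. (f x - g x)\<^sup>2)"
      then have "integrable M (\<lambda>x. ((f x - g x) - (f x - e x))\<^sup>2)"
        using fe2 by (intro integrable_square_diff[of "\<lambda>x. f x - g x" M "\<lambda>x. f x - e x"]) auto
      then show False
        using False by (simp add: h_def)
    qed
    then show ?thesis
      using False
      by (simp add: integrable_iff_bounded not_less top_unique flip: e_def h_def)
  qed
qed

end

lemma borel_measurable_vec_nth: "(\<lambda>x :: real ^ 'n. x $ i) \<in> borel_measurable borel"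
  by (intro borel_measurable_continuous_onI continuous_intros)

lemma borel_measurable_vec_lambda:
  fixes f :: "'n :: finite \<Rightarrow> 'a \<Rightarrow> real"
  assumes "\<And>i. f i \<in> borel_measurable M"
  shows "(\<lambda>x. \<chi> i. f i x) \<in> borel_measurable M"
  using assms by (subst borel_measurable_euclidean_space) (auto simp: Basis_vec_def inner_axis)

lemma norm_vec_power2_eq_sum:
  fixes x :: "real ^ 'n"
  shows "(norm x)\<^sup>2 = (\<Sum>i\<in>UNIV. (x $ i)\<^sup>2)"
  unfolding norm_vec_def L2_set_def by (simp add: sum_nonneg)

text \<open>The squared Euclidean norm is the sum of the squared coordinates. This reduces the
  vector-valued identity to the scalar one.\<close>

lemma nn_integral_norm_vec_power2:
  fixes f :: "'a \<Rightarrow> real ^ 'n"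
  assumes "f \<in> borel_measurable M"
  shows "(\<integral>\<^sup>+ x. ennreal ((norm (f x))\<^sup>2) \<partial>M) = (\<Sum>i\<in>UNIV. \<integral>\<^sup>+ x. ennreal ((f x $ i)\<^sup>2) \<partial>M)"
proof -
  have [measurable]: "(\<lambda>x. f x $ i) \<in> borel_measurable M" for i
    using borel_measurable_vec_nth assms by (rule measurable_compose[rotated])
  show ?thesis
    by (simp add: norm_vec_power2_eq_sum nn_integral_sum flip: sum_ennreal)
qed

lemma borel_measurable_vec_cond_exp: "vec_cond_exp M F Y \<in> borel_measurable F"
  unfolding vec_cond_exp_def by (rule borel_measurable_vec_lambda) simp

text \<open>Apply the scalar identity in each coordinate and sum. The second moment of each
  coordinate of \<open>Y\<close> is bounded by that of \<open>norm Y\<close>.\<close>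

lemma (in finite_measure_subalgebra) nn_integral_vec_cond_exp_Pythagoras:
  fixes Y G :: "'a \<Rightarrow> real ^ 'n"
  assumes [measurable]: "Y \<in> borel_measurable M" "G \<in> borel_measurable F"
    and Y2: "(\<integral>\<^sup>+ x. ennreal ((norm (Y x))\<^sup>2) \<partial>M) < \<infinity>"
  shows "(\<integral>\<^sup>+ x. ennreal ((norm (Y x - G x))\<^sup>2) \<partial>M)
       = (\<integral>\<^sup>+ x. ennreal ((norm (Y x - vec_cond_exp M F Y x))\<^sup>2) \<partial>M)
       + (\<integral>\<^sup>+ x. ennreal ((norm (vec_cond_exp M F Y x - G x))\<^sup>2) \<partial>M)"
proof -
  have [measurable]: "G \<in> borel_measurable M" "vec_cond_exp M F Y \<in> borel_measurable M"
    by (auto intro!: measurable_from_subalg[OF subalg] borel_measurable_vec_cond_exp)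
  have Yi: "(\<lambda>x. Y x $ i) \<in> borel_measurable M" for i
    using borel_measurable_vec_nth by (rule measurable_compose[rotated]) simp
  have Gi: "(\<lambda>x. G x $ i) \<in> borel_measurable F" for i
    using borel_measurable_vec_nth by (rule measurable_compose[rotated]) simp
  have Yi2: "integrable M (\<lambda>x. (Y x $ i)\<^sup>2)" for i
  proof -
    have "(\<integral>\<^sup>+ x. ennreal ((Y x $ i)\<^sup>2) \<partial>M) \<le> (\<integral>\<^sup>+ x. ennreal ((norm (Y x))\<^sup>2) \<partial>M)"
      by (intro nn_integral_mono ennreal_leI) (auto simp: norm_vec_power2_eq_sum intro!: member_le_sum)
    then show ?thesis
      using Y2 Yi[of i] by (auto simp: integrable_iff_bounded)
  qed
  have [simp]: "vec_cond_exp M F Y x $ i = real_cond_exp M F (\<lambda>x. Y x $ i) x" for x i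
    by (simp add: vec_cond_exp_def)
  show ?thesis
    by (simp add: nn_integral_norm_vec_power2 nn_integral_real_cond_exp_Pythagoras[OF Yi Gi Yi2]
        sum.distrib)
qed

text \<open>Pythagoras with \<open>G = 0\<close>. It serves to show that the residual error is
  finite.\<close>

lemma (in finite_measure_subalgebra) nn_integral_vec_cond_exp_le:
  fixes Y :: "'a \<Rightarrow> real ^ 'n"
  assumes "Y \<in> borel_measurable M" "(\<integral>\<^sup>+ x. ennreal ((norm (Y x))\<^sup>2) \<partial>M) < \<infinity>"
  shows "(\<integral>\<^sup>+ x. ennreal ((norm (Y x - vec_cond_exp M F Y x))\<^sup>2) \<partial>M)
       \<le> (\<integral>\<^sup>+ x. ennreal ((norm (Y x))\<^sup>2) \<partial>M)"
  using nn_integral_vec_cond_exp_Pythagoras[OF assms(1) _ assms(2), of "\<lambda>_. 0"]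
  by (simp add: le_iff_add)

lemma nn_integral_norm_power2_eq_0_iff:
  fixes f g :: "'a \<Rightarrow> 'b :: {second_countable_topology, real_normed_vector}"
  assumes [measurable]: "f \<in> borel_measurable M" "g \<in> borel_measurable M"
  shows "(\<integral>\<^sup>+ x. ennreal ((norm (f x - g x))\<^sup>2) \<partial>M) = 0 \<longleftrightarrow> (AE x in M. f x = g x)"
  by (subst nn_integral_0_iff_AE) auto

theorem theorem3p3:
  fixes V S :: "'v set"
    and M :: "'a measure"
    and X1 :: "'r1 measure"
    and X2 :: "'r2 measure"
    and R1 :: "'a \<Rightarrow> 'r1"
    and R2 :: "'a \<Rightarrow> 'r2"
    and U :: "'v \<Rightarrow> 'r1 \<Rightarrow> real ^ 'n"
    and \<phi> :: "'r1 \<times> 'r2 \<Rightarrow> real ^ 'n"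
    and L :: "'v \<Rightarrow> ennreal"
  assumes "V \<noteq> {}" and "S \<noteq> {}" and "S \<subseteq> V"
    and "prob_space M"
    and "R1 \<in> measurable M X1"
    and "R2 \<in> measurable M X2"
    and "\<And>v. v \<in> V \<Longrightarrow> U v \<in> borel_measurable X1"
    and "\<phi> \<in> borel_measurable (X1 \<Otimes>\<^sub>M X2)"
    and "(\<integral>\<^sup>+ \<omega>. ennreal ((norm (\<phi> (R1 \<omega>, R2 \<omega>)))\<^sup>2) \<partial>M) < \<infinity>"
    and "\<And>v. v \<in> V \<Longrightarrow>
          measure M {\<omega> \<in> space M.
            U v (R1 \<omega>) = cond_exp_given M X1 R1 (\<lambda>\<eta>. \<phi> (R1 \<eta>, R2 \<eta>)) \<omega>} = 1
          \<longleftrightarrow> v \<in> S"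
    and "\<And>v. v \<in> V \<Longrightarrow>
          L v = (\<integral>\<^sup>+ \<omega>. ennreal ((norm (\<phi> (R1 \<omega>, R2 \<omega>) - U v (R1 \<omega>)))\<^sup>2) \<partial>M)"
  shows "(\<forall>v\<in>V. L v = (INF w\<in>V. L w) \<longleftrightarrow> v \<in> S)
       \<and> (\<exists>v\<in>V. L v = (INF w\<in>V. L w))"
proof -
  let ?F = "vimage_algebra (space M) R1 X1"
  define Y where "Y \<omega> = \<phi> (R1 \<omega>, R2 \<omega>)" for \<omega>
  define E where "E = vec_cond_exp M ?F Y"
  \<comment> \<open>\<open>c\<close> is the error of the best approximation and is the same for all
    \<open>v\<close>; \<open>D v\<close> is the excess error of \<open>U v\<close>.\<close>
  define c where "c = (\<integral>\<^sup>+ \<omega>. ennreal ((norm (Y \<omega> - E \<omega>))\<^sup>2) \<partial>M)"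
  define D where "D v = (\<integral>\<^sup>+ \<omega>. ennreal ((norm (E \<omega> - U v (R1 \<omega>)))\<^sup>2) \<partial>M)" for v
  note [measurable] = assms(5,6,8)
  have sub: "subalgebra M ?F"
    unfolding subalgebra_def using sets_image_in_sets[OF refl assms(5)] by simp
  interpret prob_space M by fact
  interpret finite_measure_subalgebra M ?F
    by unfold_locales (rule sub)
  have [measurable]: "Y \<in> borel_measurable M"
    unfolding Y_def by measurable
  have Y2: "(\<integral>\<^sup>+ \<omega>. ennreal ((norm (Y \<omega>))\<^sup>2) \<partial>M) < \<infinity>"
    using assms(9) by (simp add: Y_def)
  have [measurable]: "E \<in> borel_measurable M"
    unfolding E_def by (rule measurable_from_subalg[OF sub borel_measurable_vec_cond_exp])
  \<comment> \<open>\<open>R1\<close> is measurable for the sigma-algebra it generates, so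
    \<open>U v (R1 \<omega>)\<close> is an admissible \<open>G\<close> in Pythagoras.\<close>
  have R1: "R1 \<in> measurable ?F X1"
    using assms(5) by (intro measurable_vimage_algebra1) (simp add: measurable_def)
  have c: "c < \<infinity>"
    unfolding c_def E_def using le_less_trans[OF nn_integral_vec_cond_exp_le[OF _ Y2] Y2] by simp
  have L: "L v = c + D v" if "v \<in> V" for v
    unfolding c_def D_def E_def assms(11)[OF that] Y_def[symmetric]
    by (rule nn_integral_vec_cond_exp_Pythagoras)
      (use Y2 measurable_compose[OF R1 assms(7)[OF that]] in auto)
  have D: "D v = 0 \<longleftrightarrow> v \<in> S" if "v \<in> V" for v
  proof -
    have [measurable]: "(\<lambda>\<omega>. U v (R1 \<omega>)) \<in> borel_measurable M"
      using assms(5) assms(7)[OF that] by (rule measurable_compose)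
    \<comment> \<open>Zero excess means almost sure equality with the chosen version
      \<open>E\<close>, which is the probability-one condition characterising
      \<open>S\<close>.\<close>
    have "D v = 0 \<longleftrightarrow> (AE \<omega> in M. U v (R1 \<omega>) = E \<omega>)"
      unfolding D_def by (subst nn_integral_norm_power2_eq_0_iff) (auto simp: eq_commute[of "E _"])
    also have "\<dots> \<longleftrightarrow> prob {\<omega> \<in> space M. U v (R1 \<omega>) = E \<omega>} = 1"
      by (rule prob_Collect_eq_1[symmetric]) measurable
    also have "\<dots> \<longleftrightarrow> v \<in> S"
      using assms(10)[OF that] by (simp add: cond_exp_given_def E_def Y_def[abs_def])
    finally show ?thesis .
  qed
  \<comment> \<open>Finiteness of \<open>c\<close> is what permits cancelling it in
    \<open>c + D v = c\<close> over \<open>ennreal\<close>.\<close>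
  have LS: "L v = c \<longleftrightarrow> v \<in> S" if "v \<in> V" for v
    using L[OF that] D[OF that] c ennreal_add_left_cancel[of c "D v" 0] by auto
  obtain s where s: "s \<in> S" "s \<in> V"
    using assms(2,3) by auto
  \<comment> \<open>The bound \<open>c\<close> lies below every \<open>c + D w\<close> and is
    attained at \<open>s\<close>.\<close>
  have "(INF w\<in>V. L w) = c"
  proof (rule antisym)
    show "(INF w\<in>V. L w) \<le> c"
      using LS[OF s(2)] s by (auto intro: INF_lower2)
    show "c \<le> (INF w\<in>V. L w)"
      by (rule INF_greatest) (simp add: L)
  qed
  then show ?thesis
    using LS s by auto
qed

end
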